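(* Let $(r,b)$ be a two-parameter token bucket, fed by a general (arbitrary) message arrival process in which each message requires one token to exit the bucket. Let $k$ be a positive integer and let $(r_l,b_l)$, $l=1,\dots,k$, be token bucket parameters with $r=\sum_{l=1}^k r_l$ and $b=\sum_{l=1}^k b_l$. Consider the $k$-bucket system obtained by replacing the single bucket with $k$ separate sub-token buckets $(r_l,b_l)$, where the same stream of messages is distributed in an arbitrary way among the $k$ sub-token buckets, each message being assigned to one sub-token bucket at its arrival time. All buckets are full, with no messages waiting, at time $0$. Let $S(t)$ and $S^{(k)}(t)$ denote the sum of the delays accrued by all messages up to time $t$ in the one-bucket and in the $k$-bucket system, respectively. Then, irrespective of how messages are distributed to the $k$ sub-token buckets, $$S^{(k)}(t)\ \ge\ S(t)\qquad\text{for all } t\ge 0.$$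
   Context: Token bucket $(r,b)$: $r>0$ is the token rate (tokens per unit time) and $b\ge 0$ the bucket size; both are real. Tokens are generated continuously (fluidly) at rate $r$ and accumulate in the bucket up to at most $b$ tokens; tokens generated while the bucket holds $b$ tokens are lost. Each message consumes exactly one token. A message that finds at least one full token (and no waiting messages) upon arrival leaves immediately, with zero delay, and removes one token. Otherwise (the bucket is empty or contains only a fraction of a token) it waits until a full token is available. The waiting space of each bucket is infinite, so no message is lost. The operation is work-conserving: whenever messages are waiting at a bucket, one of them leaves (consuming one token) as soon as a full token is available in that bucket; the order in which waiting messages of a bucket are served is first-come-first-served, though any order may be used. In the $k$-bucket system each sub-token bucket operates independently according to these rules, with its own parameters $(r_l,b_l)$, its own tokens and its own infinite queue. Arrivals: message arrival times form an arbitrary sequence of nonnegative times (simultaneous arrivals allowed), with finitely many arrivals in every bounded time interval; the inequality is understood for every realization of the arrivals. Accrued delay: a message accrues delay at unit rate while it is waiting for a token. Thus, if $N(u)$ is the number of messages waiting at time $u$ in the one-bucket system and $N_l(u)$ is the number waiting at time $u$ in the $l$-th sub-token bucket, then $S(t)=\int_0^t N(u)\,du$ and $S^{(k)}(t)=\int_0^t\sum_{l=1}^k N_l(u)\,du$. *)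

theory Defs
  imports "HOL-Analysis.Analysis"
begin

text \<open>
  A realization of the arrivals is a family of messages \<open>m \<in> M\<close> with arrival times \<open>arr m\<close>;
  \<open>M\<close> may be finite or infinite, and distinct messages may have equal arrival times.
\<close>

locale arrivals =
  fixes M :: "'m set" and arr :: "'m \<Rightarrow> real"
  assumes arr_nonneg: "m \<in> M \<Longrightarrow> 0 \<le> arr m"
    and locally_finite: "finite {m \<in> M. arr m \<le> t}"

text \<open>
  The departure time \<open>dep m\<close> is \<open>\<infinity>\<close> if \<open>m\<close> never leaves, which happens when
  the bucket size is less than 1, since then a full token is never available.
\<close>

definition departures_at :: "'m set \<Rightarrow> ('m \<Rightarrow> ereal) \<Rightarrow> real \<Rightarrow> nat"
  where "departures_at M dep t = card {m \<in> M. dep m = ereal t}"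

definition waiting :: "'m set \<Rightarrow> ('m \<Rightarrow> real) \<Rightarrow> ('m \<Rightarrow> ereal) \<Rightarrow> real \<Rightarrow> nat"
  where "waiting M arr dep u = card {m \<in> M. arr m \<le> u \<and> ereal u < dep m}"

text \<open>
  \<open>L t\<close> is the number of tokens in the bucket at time \<open>t\<close> just \<^emph>\<open>before\<close> the departures at
  time \<open>t\<close>, so \<open>L t - departures_at M dep t\<close> is the number of tokens just after them, whereas
  \<open>waiting\<close> counts the messages left waiting \<^emph>\<open>after\<close> the departures at that time.
  A message that departs at its arrival time has zero delay; \<open>work_conserving\<close> forces this if
  it finds a full token and no competing message. The order of service is not
  prescribed: first-come-first-served is one of the admissible choices of \<open>dep\<close>.
\<close>

locale token_bucket = arrivals M arr
  for M :: "'m set" and arr :: "'m \<Rightarrow> real" +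
  fixes r b :: real and dep :: "'m \<Rightarrow> ereal" and L :: "real \<Rightarrow> real"
  assumes rate_pos: "0 < r"
    and size_nonneg: "0 \<le> b"
    and causal: "m \<in> M \<Longrightarrow> ereal (arr m) \<le> dep m"
    and initially_full: "L 0 = b"
    and refill: "\<lbrakk>0 \<le> s; s < t; \<And>u. \<lbrakk>s < u; u < t\<rbrakk> \<Longrightarrow> departures_at M dep u = 0\<rbrakk> \<Longrightarrow>
      L t = min b (L s - real (departures_at M dep s) + r * (t - s))"
    and one_token_each: "0 \<le> t \<Longrightarrow> real (departures_at M dep t) \<le> L t"
    and work_conserving: "\<lbrakk>0 \<le> t; 0 < waiting M arr dep t\<rbrakk> \<Longrightarrow>
      L t - real (departures_at M dep t) < 1"

definition accrued_delay :: "'m set \<Rightarrow> ('m \<Rightarrow> real) \<Rightarrow> ('m \<Rightarrow> ereal) \<Rightarrow> real \<Rightarrow> real"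
  where "accrued_delay M arr dep t = integral {0..t} (\<lambda>u. real (waiting M arr dep u))"

text \<open>
  In the \<open>k\<close>-bucket system, message \<open>m\<close> is assigned to the bucket \<open>\<sigma> m \<in> {1..k}\<close>. Each message
  is in exactly one bucket, so one function \<open>dep\<close> records all departure times.
\<close>

definition substream :: "'m set \<Rightarrow> ('m \<Rightarrow> nat) \<Rightarrow> nat \<Rightarrow> 'm set"
  where "substream M \<sigma> l = {m \<in> M. \<sigma> m = l}"

locale multi_token_bucket =
  fixes M :: "'m set" and arr :: "'m \<Rightarrow> real" and k :: nat and r b :: "nat \<Rightarrow> real"
    and \<sigma> :: "'m \<Rightarrow> nat" and dep :: "'m \<Rightarrow> ereal" and L :: "nat \<Rightarrow> real \<Rightarrow> real"
  assumes assignment: "m \<in> M \<Longrightarrow> \<sigma> m \<in> {1..k}"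
    and bucket: "l \<in> {1..k} \<Longrightarrow> token_bucket (substream M \<sigma> l) arr (r l) (b l) dep (L l)"

definition multi_accrued_delay ::
    "'m set \<Rightarrow> ('m \<Rightarrow> real) \<Rightarrow> nat \<Rightarrow> ('m \<Rightarrow> nat) \<Rightarrow> ('m \<Rightarrow> ereal) \<Rightarrow> real \<Rightarrow> real"
  where "multi_accrued_delay M arr k \<sigma> dep t =
    integral {0..t} (\<lambda>u. \<Sum>l = 1..k. real (waiting (substream M \<sigma> l) arr dep u))"

end

theory Submission
  imports Defs
begin

text \<open>
  The inequality holds pointwise for the numbers of waiting messages. Let \<open>Z\<close> be the number of
  tokens minus the number of waiting messages, both just after the departures at time \<open>t\<close>.
  In every bucket, \<open>Z t \<le> b + r * (t - s) - A\<close> for each \<open>s \<le> t\<close>, where \<open>A\<close> is the number of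
  arrivals in \<open>[s, t]\<close>; if \<open>b \<ge> 1\<close>, work conservation prevents an overflow while messages wait,
  so equality is attained at some \<open>s\<close>. These bounds add up over the sub-buckets, hence
  \<open>(\<Sum>l. Z\<^sub>l t) \<le> Z t\<close>. If messages wait in the single bucket, it holds less than one token, so their
  number is less than \<open>1 - Z t \<le> 1 + (\<Sum>l. N\<^sub>l t)\<close>, and integrality concludes.
  If \<open>b < 1\<close>, no message ever leaves in either system.
\<close>

section \<open>Counting functions and integrability\<close>

text \<open>The strict counts are left limits: \<open>arrivals_upto\<close> at \<open>t\<close>
  minus \<open>arrivals_before\<close> at \<open>s\<close> counts the closed interval from
  \<open>s\<close> to \<open>t\<close>, and \<open>departures_before\<close> matches
  \<open>L\<close>, the level just before the departures.\<close>

definition arrivals_before :: "'m set \<Rightarrow> ('m \<Rightarrow> real) \<Rightarrow> real \<Rightarrow> nat"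
  where "arrivals_before M arr t = card {m \<in> M. arr m < t}"

definition arrivals_upto :: "'m set \<Rightarrow> ('m \<Rightarrow> real) \<Rightarrow> real \<Rightarrow> nat"
  where "arrivals_upto M arr t = card {m \<in> M. arr m \<le> t}"

definition departures_before :: "'m set \<Rightarrow> ('m \<Rightarrow> ereal) \<Rightarrow> real \<Rightarrow> nat"
  where "departures_before M dep t = card {m \<in> M. dep m < ereal t}"

text \<open>On a bounded interval only finitely many messages matter, and each contributes the
  indicator of an interval.\<close>

lemma (in arrivals) integrable_waiting:
  "(\<lambda>u. real (waiting M arr dep u)) integrable_on {0..t}"
proof -
  let ?F = "{m \<in> M. arr m \<le> t}"
  let ?I = "\<lambda>m. {u. arr m \<le> u \<and> ereal u < dep m}"
  have "(indicator (?I m) :: real \<Rightarrow> real) integrable_on {0..t}" for m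
  proof -
    have "?I m \<in> sets borel" by measurable
    then have "?I m \<inter> {0..t} \<in> lmeasurable"
      by (intro bounded_set_imp_lmeasurable) (auto intro: bounded_subset[of "{0..t}"])
    then show ?thesis by (simp add: integrable_on_indicator)
  qed
  then have "(\<lambda>u. \<Sum>m\<in>?F. indicator (?I m) u :: real) integrable_on {0..t}"
    by (intro integrable_sum locally_finite) auto
  moreover have "(\<Sum>m\<in>?F. indicator (?I m) u) = real (waiting M arr dep u)"
    if "u \<in> {0..t}" for u
  proof -
    have "(\<Sum>m\<in>?F. indicator (?I m) u) = real (card (?F \<inter> {m. u \<in> ?I m}))"
      using locally_finite[of t] by (simp add: indicator_def sum.If_cases)
    also have "?F \<inter> {m. u \<in> ?I m} = {m \<in> M. arr m \<le> u \<and> ereal u < dep m}"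
      using that by auto
    finally show ?thesis by (simp add: waiting_def)
  qed
  ultimately show ?thesis
    by (rule integrable_eq)
qed

section \<open>Counting identities for one bucket\<close>

context token_bucket
begin

lemma arr_le:
  assumes "m \<in> M" "dep m \<le> ereal t" shows "arr m \<le> t"
  using order_trans[OF causal[OF assms(1)] assms(2)] by simp

lemma arr_less:
  assumes "m \<in> M" "dep m < ereal t" shows "arr m < t"
  using le_less_trans[OF causal[OF assms(1)] assms(2)] by simp

lemma finite_departed:
  "finite {m \<in> M. dep m \<le> ereal t}"
proof (rule finite_subset[OF _ locally_finite[of t]])
  show "{m \<in> M. dep m \<le> ereal t} \<subseteq> {m \<in> M. arr m \<le> t}"
    using arr_le by auto
qed

lemma departures_at_eq_0_iff:
  "departures_at M dep t = 0 \<longleftrightarrow> (\<forall>m\<in>M. dep m \<noteq> ereal t)"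
proof -
  have "finite {m \<in> M. dep m = ereal t}"
    by (rule finite_subset[OF _ finite_departed[of t]]) auto
  then show ?thesis by (auto simp: departures_at_def)
qed

lemma departures_before_add_at:
  "departures_before M dep t + departures_at M dep t = card {m \<in> M. dep m \<le> ereal t}"
proof -
  have "{m \<in> M. dep m \<le> ereal t} = {m \<in> M. dep m < ereal t} \<union> {m \<in> M. dep m = ereal t}"
    by auto
  moreover have "finite {m \<in> M. dep m < ereal t}" "finite {m \<in> M. dep m = ereal t}"
    by (rule finite_subset[OF _ finite_departed[of t]]; auto)+
  ultimately show ?thesis
    unfolding departures_before_def departures_at_def
    by (subst card_Un_disjoint[symmetric]) auto
qed

lemma departures_before_0: "departures_before M dep 0 = 0"
proof -
  have "{m \<in> M. dep m < ereal 0} = {}"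
    using arr_less arr_nonneg by fastforce
  then show ?thesis unfolding departures_before_def by (simp only: card.empty)
qed

lemma departures_before_le_arrivals:
  "departures_before M dep t \<le> arrivals_before M arr t"
  unfolding departures_before_def arrivals_before_def
proof (rule card_mono)
  show "finite {m \<in> M. arr m < t}"
    by (rule finite_subset[OF _ locally_finite[of t]]) auto
  show "{m \<in> M. dep m < ereal t} \<subseteq> {m \<in> M. arr m < t}"
    using arr_less by auto
qed

lemma waiting_add_departed:
  "waiting M arr dep t + departures_before M dep t + departures_at M dep t = arrivals_upto M arr t"
proof -
  have "{m \<in> M. arr m \<le> t} =
      {m \<in> M. arr m \<le> t \<and> ereal t < dep m} \<union> {m \<in> M. dep m \<le> ereal t}"
    using arr_le by auto
  moreover have "finite {m \<in> M. arr m \<le> t \<and> ereal t < dep m}"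
    by (rule finite_subset[OF _ locally_finite[of t]]) auto
  ultimately have "arrivals_upto M arr t = waiting M arr dep t + card {m \<in> M. dep m \<le> ereal t}"
    using finite_departed[of t]
    by (auto simp: arrivals_upto_def waiting_def disjoint_iff intro!: card_Un_disjoint)
  then show ?thesis using departures_before_add_at[of t] by simp
qed

lemma departures_before_step:
  assumes "s < t" and idle: "\<And>u. \<lbrakk>s < u; u < t\<rbrakk> \<Longrightarrow> departures_at M dep u = 0"
  shows "departures_before M dep t = departures_before M dep s + departures_at M dep s"
proof -
  have "{m \<in> M. dep m < ereal t} = {m \<in> M. dep m \<le> ereal s}" (is "?A = ?B")
  proof
    show "?B \<subseteq> ?A" using \<open>s < t\<close> by (auto intro: le_less_trans)
    show "?A \<subseteq> ?B"
    proof
      fix m assume m: "m \<in> ?A"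
      show "m \<in> ?B"
      proof (cases "dep m")
        case (real u)
        then show ?thesis using m idle[of u] by (force simp: departures_at_eq_0_iff)
      qed (use m in auto)
    qed
  qed
  then show ?thesis using departures_before_add_at[of s] by (simp add: departures_before_def)
qed

section \<open>Induction along departure times\<close>

text \<open>\<open>refill\<close> only describes idle intervals. As finitely many messages leave by
  time \<open>t\<close>, any departure times strictly between \<open>a\<close> and \<open>t\<close>
  include a last one, \<open>s\<close>, with an idle interval after it. The measure
  \<open>departures_before\<close> drops from \<open>t\<close> to \<open>s\<close>, because someone
  departs at \<open>s\<close> itself.\<close>

lemma departure_induct [consumes 2, case_names base step]:
  assumes "0 \<le> a" "a \<le> t" "Q a"
    and step: "\<And>s t. \<lbrakk>a \<le> s; s < t; Q s; \<And>u. \<lbrakk>s < u; u < t\<rbrakk> \<Longrightarrow> departures_at M dep u = 0\<rbrakk> \<Longrightarrow> Q t"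
  shows "Q t"
  using \<open>a \<le> t\<close>
proof (induction "departures_before M dep t" arbitrary: t rule: less_induct)
  case less
  define T where "T = {u. a < u \<and> u < t \<and> departures_at M dep u \<noteq> 0}"
  have fin: "finite T"
  proof (rule finite_subset)
    show "T \<subseteq> (\<lambda>m. real_of_ereal (dep m)) ` {m \<in> M. dep m \<le> ereal t}"
      by (force simp: T_def departures_at_eq_0_iff image_iff)
    show "finite \<dots>" using finite_departed by blast
  qed
  show ?case
  proof (cases "t = a")
    case True then show ?thesis using \<open>Q a\<close> by simp
  next
    case False
    with less.prems have "a < t" by simp
    show ?thesis
    proof (cases "T = {}")
      case True
      then show ?thesis using step[OF order_refl \<open>a < t\<close> \<open>Q a\<close>] by (auto simp: T_def)
    next
      case False
      define s where "s = Max T"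
      have s: "a < s" "s < t" "departures_at M dep s \<noteq> 0"
        using Max_in[OF fin False] by (auto simp: s_def T_def)
      have idle: "departures_at M dep u = 0" if "s < u" "u < t" for u
        using Max_ge[OF fin, of u] that s by (force simp: s_def T_def)
      have "departures_before M dep s < departures_before M dep t"
        using departures_before_step[OF \<open>s < t\<close> idle] s by simp
      then have "Q s" using less.hyps s by simp
      then show ?thesis using step[of s t] s idle by simp
    qed
  qed
qed

section \<open>Bounds on the token level\<close>

lemma level_le_size:
  assumes "0 \<le> t" shows "L t \<le> b"
  using order_refl assms
proof (induction rule: departure_induct)
  case base then show ?case by (simp add: initially_full)
next
  case (step s t)
  then show ?case using refill[of s t] by simp
qed

text \<open>Adding the departures back cancels the consumption of tokens; what remains grows by the
  generated tokens, less those lost to overflow.\<close>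

lemma level_add_departures_le:
  assumes "0 \<le> s" "s \<le> t"
  shows "L t + departures_before M dep t \<le> L s + departures_before M dep s + r * (t - s)"
  using assms
proof (induction rule: departure_induct)
  case base then show ?case by simp
next
  case (step u t)
  have "L t \<le> L u - real (departures_at M dep u) + r * (t - u)"
    using refill[of u t] step assms by simp
  then show ?case
    using step departures_before_step[of u t] by (simp add: algebra_simps)
qed

text \<open>The witness \<open>s\<close> is a time when the bucket is full and all earlier arrivals
  have left, with no token lost between \<open>s\<close> and \<open>t\<close>. Such a time is 0 at
  first; an overflow yields a new one, since with \<open>1 \<le> b\<close> no message can wait at a
  full bucket.\<close>

lemma level_add_departures_ge:
  assumes "1 \<le> b" "0 \<le> t"
  obtains s where "0 \<le> s" "s \<le> t"
    "b + arrivals_before M arr s + r * (t - s) \<le> L t + departures_before M dep t"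
proof -
  have "\<exists>s\<ge>0. s \<le> t \<and> b + arrivals_before M arr s + r * (t - s) \<le> L t + departures_before M dep t"
    using order_refl \<open>0 \<le> t\<close>
  proof (induction rule: departure_induct)
    case base
    have "{m \<in> M. arr m < 0} = {}" using arr_nonneg by force
    then have "arrivals_before M arr 0 = 0"
      unfolding arrivals_before_def by (simp only: card.empty)
    then show ?case by (intro exI[of _ 0]) (simp add: initially_full)
  next
    case (step u t)
    let ?x = "L u - real (departures_at M dep u)"
    \<comment> \<open>The refill law is needed at intermediate times too, for the instant
      \<open>w\<close> below.\<close>
    have L: "L v = min b (?x + r * (v - u))" if "u < v" "v \<le> t" for v
      using refill[of u v] step that by simp
    have D: "departures_before M dep t = departures_before M dep u + departures_at M dep u"
      using departures_before_step[of u t] step by simp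
    show ?case
    \<comment> \<open>Without overflow the sum of level and departures grows at exactly rate
      \<open>r\<close>, so the old \<open>s\<close> still serves; after an overflow \<open>t\<close>
      itself is the new witness.\<close>
    proof (cases "?x + r * (t - u) \<le> b")
      case True
      obtain s where "0 \<le> s" "s \<le> u"
        "b + arrivals_before M arr s + r * (u - s) \<le> L u + departures_before M dep u"
        using step by blast
      then show ?thesis
        using L[of t] D True step by (intro exI[of _ s]) (simp add: algebra_simps)
    next
      case False
      \<comment> \<open>The time at which the uncapped level \<open>?x + r * (v - u)\<close> reaches
        \<open>b\<close>.\<close>
      define v where "v = t - (?x + r * (t - u) - b) / r"
      have "0 < r" by (rule rate_pos)
      then have "v < t" using False by (simp add: v_def)
      have full: "b \<le> ?x + r * (w - u)" if "v \<le> w" for w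
      proof -
        have "r * v \<le> r * w" using that \<open>0 < r\<close> by simp
        moreover have "r * v = b - ?x + r * u"
          using \<open>0 < r\<close> by (simp add: v_def field_simps)
        ultimately show ?thesis by (simp add: algebra_simps)
      qed
      have "{m \<in> M. arr m < t} \<subseteq> {m \<in> M. dep m < ereal t}"
      proof (rule ccontr)
        assume "\<not> ?thesis"
        then obtain m where m: "m \<in> M" "arr m < t" "ereal t \<le> dep m" by force
        \<comment> \<open>An instant in the idle interval after \<open>u\<close> and before
          \<open>t\<close> at which \<open>m\<close> has arrived and the bucket is full; the
          midpoint keeps \<open>w\<close> strictly above \<open>u\<close>.\<close>
        define w where "w = Max {arr m, v, (u + t) / 2}"
        have w: "arr m \<le> w" "v \<le> w" "u < w" "w < t"
          using m \<open>v < t\<close> step by (auto simp: w_def less_max_iff_disj)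
        have "finite {m \<in> M. arr m \<le> w \<and> ereal w < dep m}"
          by (rule finite_subset[OF _ locally_finite[of w]]) auto
        moreover have "m \<in> {m \<in> M. arr m \<le> w \<and> ereal w < dep m}"
          using m w less_le_trans[of "ereal w" "ereal t"] by simp
        ultimately have "0 < waiting M arr dep w"
          by (auto simp: waiting_def card_gt_0_iff)
        then have "L w < 1"
          using work_conserving[of w] step w by simp
        moreover have "L w = b" using L[of w] full[of w] w by simp
        ultimately show False using \<open>1 \<le> b\<close> by simp
      qed
      then have "arrivals_before M arr t \<le> departures_before M dep t"
        unfolding arrivals_before_def departures_before_def
        by (intro card_mono finite_subset[OF _ finite_departed[of t]]) auto
      moreover have "L t = b" using L[of t] False step by simp
      ultimately show ?thesis using step by (intro exI[of _ t]) simp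
    qed
  qed
  then show thesis using that by blast
qed

section \<open>Bounds on the number of waiting messages\<close>

text \<open>At \<open>s\<close> the level is at most \<open>b\<close> and departures do not exceed
  arrivals; at \<open>t\<close> the tokens left after the departures are nonnegative. Conservation
  of messages turns the resulting bound on departures into one on waiting messages.\<close>

lemma waiting_ge:
  assumes "0 \<le> s" "s \<le> t"
  shows "real (arrivals_upto M arr t) - arrivals_before M arr s - b - r * (t - s)
    \<le> waiting M arr dep t"
  using level_add_departures_le[OF assms] level_le_size[of s] one_token_each[of t]
    departures_before_le_arrivals[of s] waiting_add_departed[of t] assms
  by simp

text \<open>The tokens left over at \<open>t\<close>, fewer than one by work conservation, account
  for the slack of 1 against \<open>waiting_ge\<close>.\<close>

lemma waiting_less:
  assumes "1 \<le> b" "0 \<le> t" "0 < waiting M arr dep t"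
  obtains s where "0 \<le> s" "s \<le> t"
    "waiting M arr dep t < 1 + (real (arrivals_upto M arr t) - arrivals_before M arr s - b - r * (t - s))"
proof -
  obtain s where "0 \<le> s" "s \<le> t"
    "b + arrivals_before M arr s + r * (t - s) \<le> L t + departures_before M dep t"
    using level_add_departures_ge assms by blast
  then show thesis
    using work_conserving[OF assms(2,3)] waiting_add_departed[of t] by (intro that[of s]) auto
qed

text \<open>The level never reaches 1, so the integer number of departures at any time is 0.\<close>

lemma waiting_small_bucket:
  assumes "b < 1" "0 \<le> t"
  shows "waiting M arr dep t = arrivals_upto M arr t"
proof -
  have none: "departures_at M dep u = 0" if "0 \<le> u" for u
    using one_token_each[OF that] level_le_size[OF that] \<open>b < 1\<close> by simp
  have "departures_before M dep t = 0"
    using departures_before_step[of 0 t] none departures_before_0 \<open>0 \<le> t\<close>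
    by (cases "t = 0") auto
  then show ?thesis using waiting_add_departed[of t] none[OF \<open>0 \<le> t\<close>] by simp
qed

end

section \<open>Comparison of the two systems\<close>

context multi_token_bucket
begin

lemma card_eq_sum_substream:
  assumes "finite {m \<in> M. P m}"
  shows "card {m \<in> M. P m} = (\<Sum>l = 1..k. card {m \<in> substream M \<sigma> l. P m})"
proof -
  have "{m \<in> M. P m} = (\<Union>l\<in>{1..k}. {m \<in> substream M \<sigma> l. P m})"
    using assignment by (auto simp: substream_def)
  moreover have "card \<dots> = (\<Sum>l = 1..k. card {m \<in> substream M \<sigma> l. P m})"
    by (rule card_UN_disjoint)
      (auto simp: substream_def intro: finite_subset[OF _ assms])
  ultimately show ?thesis by simp
qed

text \<open>The single bucket selects one time \<open>s\<close>; since \<open>waiting_ge\<close>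
  holds for every \<open>s\<close>, this same time can be used in all sub-buckets, where rates,
  sizes and arrival counts add up.\<close>

lemma waiting_le_sum_waiting:
  assumes single: "token_bucket M arr (\<Sum>l = 1..k. r l) (\<Sum>l = 1..k. b l) dep' L'" and "0 \<le> t"
  shows "waiting M arr dep' t \<le> (\<Sum>l = 1..k. waiting (substream M \<sigma> l) arr dep t)"
proof -
  interpret single: token_bucket M arr "\<Sum>l = 1..k. r l" "\<Sum>l = 1..k. b l" dep' L'
    by (fact single)
  have upto: "arrivals_upto M arr t = (\<Sum>l = 1..k. arrivals_upto (substream M \<sigma> l) arr t)"
    unfolding arrivals_upto_def by (rule card_eq_sum_substream[OF single.locally_finite])
  show ?thesis
  proof (cases "1 \<le> (\<Sum>l = 1..k. b l)")
    case False
    have "waiting (substream M \<sigma> l) arr dep t = arrivals_upto (substream M \<sigma> l) arr t"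
      if l: "l \<in> {1..k}" for l
    proof -
      \<comment> \<open>Sizes are nonnegative, so a total below 1 makes every sub-bucket smaller
        than 1, and all arrivals wait in both systems.\<close>
      have "b l \<le> (\<Sum>l = 1..k. b l)"
        by (rule member_le_sum[OF l]) (auto intro: token_bucket.size_nonneg[OF bucket])
      then show ?thesis
        using token_bucket.waiting_small_bucket[OF bucket[OF l]] False \<open>0 \<le> t\<close> by simp
    qed
    then show ?thesis
      using single.waiting_small_bucket[OF _ \<open>0 \<le> t\<close>] False upto by simp
  next
    case True
    show ?thesis
    proof (cases "waiting M arr dep' t = 0")
      case False
      then obtain s where s: "0 \<le> s" "s \<le> t" and
        less: "waiting M arr dep' t < 1 + (real (arrivals_upto M arr t) - arrivals_before M arr s
          - (\<Sum>l = 1..k. b l) - (\<Sum>l = 1..k. r l) * (t - s))"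
        using single.waiting_less[OF True \<open>0 \<le> t\<close>] by blast
      have "finite {m \<in> M. arr m < s}"
        by (rule finite_subset[OF _ single.locally_finite[of s]]) auto
      then have before:
        "arrivals_before M arr s = (\<Sum>l = 1..k. arrivals_before (substream M \<sigma> l) arr s)"
        unfolding arrivals_before_def by (rule card_eq_sum_substream)
      have "real (arrivals_upto M arr t) - arrivals_before M arr s
          - (\<Sum>l = 1..k. b l) - (\<Sum>l = 1..k. r l) * (t - s)
        = (\<Sum>l = 1..k. real (arrivals_upto (substream M \<sigma> l) arr t)
            - arrivals_before (substream M \<sigma> l) arr s - b l - r l * (t - s))"
        by (simp add: upto before sum_subtractf sum_distrib_right)
      also have "\<dots> \<le> (\<Sum>l = 1..k. real (waiting (substream M \<sigma> l) arr dep t))"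
        by (intro sum_mono token_bucket.waiting_ge[OF bucket] s)
      \<comment> \<open>Both counts are integers, so being strictly less than the sum plus 1 means
        being at most the sum.\<close>
      finally show ?thesis using less by (simp flip: of_nat_sum)
    qed simp
  qed
qed

end

section \<open>Integration of the pointwise inequality\<close>

theorem proposition1:
  fixes M :: "'m set" and arr :: "'m \<Rightarrow> real"
    and r b :: real and dep :: "'m \<Rightarrow> ereal" and L :: "real \<Rightarrow> real"
    and k :: nat and r_sub b_sub :: "nat \<Rightarrow> real" and \<sigma> :: "'m \<Rightarrow> nat"
    and dep_sub :: "'m \<Rightarrow> ereal" and L_sub :: "nat \<Rightarrow> real \<Rightarrow> real"
  assumes "arrivals M arr"
    and "k \<ge> 1"
    and "r = (\<Sum>l = 1..k. r_sub l)"
    and "b = (\<Sum>l = 1..k. b_sub l)"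
    and "token_bucket M arr r b dep L"
    and "multi_token_bucket M arr k r_sub b_sub \<sigma> dep_sub L_sub"
  shows "\<forall>t\<ge>0. multi_accrued_delay M arr k \<sigma> dep_sub t \<ge> accrued_delay M arr dep t"
proof (intro allI impI)
  fix t :: real
  interpret multi_token_bucket M arr k r_sub b_sub \<sigma> dep_sub L_sub by fact
  show "accrued_delay M arr dep t \<le> multi_accrued_delay M arr k \<sigma> dep_sub t"
    unfolding accrued_delay_def multi_accrued_delay_def
  proof (rule integral_le)
    show "(\<lambda>u. real (waiting M arr dep u)) integrable_on {0..t}"
      by (rule arrivals.integrable_waiting) fact
    have "arrivals (substream M \<sigma> l) arr" if "l \<in> {1..k}" for l
      using bucket[OF that] by (rule token_bucket.axioms)
    then show "(\<lambda>u. \<Sum>l = 1..k. real (waiting (substream M \<sigma> l) arr dep_sub u)) integrable_on {0..t}"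
      by (intro integrable_sum arrivals.integrable_waiting) auto
  next
    fix u assume "u \<in> {0..t}"
    then have "waiting M arr dep u \<le> (\<Sum>l = 1..k. waiting (substream M \<sigma> l) arr dep_sub u)"
      using waiting_le_sum_waiting[of dep L u] assms by simp
    then show "real (waiting M arr dep u) \<le> (\<Sum>l = 1..k. real (waiting (substream M \<sigma> l) arr dep_sub u))"
      by (simp flip: of_nat_sum)
  qed
qed

end
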